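(* Let $N=\{1,\dots,n\}$ be a finite player set. For every regular cooperative game $v\colon 2^N\to\mathbb R$ on $N$, the dual Gately value of $v$ equals the Gately value of $v$, i.e., $\overline g_i(v)=g_i(v)$ for all $i\in N$.
   Context: A cooperative game on $N$ is a function $v\colon 2^N\to\mathbb R$ with $v(\varnothing)=0$. Write $v_i=v(\{i\})$ and $M_i(v)=v(N)-v(N\setminus\{i\})$ for $i\in N$. The game $v$ is regular if: (essential) $\sum_{j\in N}v_j\leqslant v(N)\leqslant\sum_{j\in N}M_j(v)$; and (standard) $v_i\leqslant M_i(v)$ for every $i\in N$, with $v_j<M_j(v)$ for at least one $j\in N$. For any game $w$ on $N$ with $\sum_{j\in N}(M_j(w)-w_j)\neq 0$ the Gately value is given by $$g_i(w)=w_i+\frac{M_i(w)-w_i}{\sum_{j\in N}(M_j(w)-w_j)}\Big(w(N)-\sum_{j\in N}w_j\Big),\qquad i\in N.$$ The dual game $v^*$ of $v$ is defined by $v^*(S)=v(N)-v(N\setminus S)$ for every $S\subseteq N$. The dual Gately value of a regular game $v$ is the Gately value formula applied to the dual game: $\overline g(v)=g(v^* )$. *)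

theory Defs
  imports Complex_Main
begin

text \<open>
  A game on a player set \<open>N\<close> is a function on all sets of players of which only the values on
  subsets of \<open>N\<close> matter.
\<close>

definition coop_game :: "('a set \<Rightarrow> real) \<Rightarrow> bool" where
  "coop_game v \<longleftrightarrow> v {} = 0"

definition marginal :: "'a set \<Rightarrow> ('a set \<Rightarrow> real) \<Rightarrow> 'a \<Rightarrow> real" where
  "marginal N v i = v N - v (N - {i})"

definition essential :: "'a set \<Rightarrow> ('a set \<Rightarrow> real) \<Rightarrow> bool" where
  "essential N v \<longleftrightarrow> (\<Sum>j\<in>N. v {j}) \<le> v N \<and> v N \<le> (\<Sum>j\<in>N. marginal N v j)"

definition standard :: "'a set \<Rightarrow> ('a set \<Rightarrow> real) \<Rightarrow> bool" where
  "standard N v \<longleftrightarrow>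
     (\<forall>i\<in>N. v {i} \<le> marginal N v i) \<and> (\<exists>j\<in>N. v {j} < marginal N v j)"

definition regular_game :: "'a set \<Rightarrow> ('a set \<Rightarrow> real) \<Rightarrow> bool" where
  "regular_game N v \<longleftrightarrow> coop_game v \<and> essential N v \<and> standard N v"

text \<open>
  The Gately value is meant only for games with \<open>gately_defined\<close>; elsewhere the formula below
  takes the meaningless value given by division by zero.
\<close>

definition gately_defined :: "'a set \<Rightarrow> ('a set \<Rightarrow> real) \<Rightarrow> bool" where
  "gately_defined N w \<longleftrightarrow> (\<Sum>j\<in>N. marginal N w j - w {j}) \<noteq> 0"

definition gately :: "'a set \<Rightarrow> ('a set \<Rightarrow> real) \<Rightarrow> 'a \<Rightarrow> real" where
  "gately N w i =
     w {i} + (marginal N w i - w {i}) / (\<Sum>j\<in>N. marginal N w j - w {j})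
               * (w N - (\<Sum>j\<in>N. w {j}))"

definition dual_game :: "'a set \<Rightarrow> ('a set \<Rightarrow> real) \<Rightarrow> 'a set \<Rightarrow> real" where
  "dual_game N v S = v N - v (N - S)"

definition dual_gately :: "'a set \<Rightarrow> ('a set \<Rightarrow> real) \<Rightarrow> 'a \<Rightarrow> real" where
  "dual_gately N v = gately N (dual_game N v)"

text \<open>
  For a regular game both the game and its dual lie in the domain of the Gately value, so
  division by zero plays no role for them.
\<close>

lemma coop_game_dual: "coop_game (dual_game N v)"
  by (simp add: coop_game_def dual_game_def)

lemma gately_defined_regular:
  assumes "finite N" "regular_game N v"
  shows "gately_defined N v"
proof -
  have "0 < (\<Sum>j\<in>N. marginal N v j - v {j})"
    using assms by (auto simp: regular_game_def standard_def intro: sum_pos2)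
  then show ?thesis by (simp add: gately_defined_def)
qed

lemma gately_defined_dual:
  assumes "finite N" "regular_game N v"
  shows "gately_defined N (dual_game N v)"
proof -
  have "marginal N (dual_game N v) j - dual_game N v {j} = - (marginal N v j - v {j})"
    if "j \<in> N" for j
  proof -
    have "N - (N - {j}) = {j}" using that by blast
    then show ?thesis
      using assms by (simp add: marginal_def dual_game_def regular_game_def coop_game_def)
  qed
  then have "(\<Sum>j\<in>N. marginal N (dual_game N v) j - dual_game N v {j})
      = - (\<Sum>j\<in>N. marginal N v j - v {j})"
    by (simp only: sum_negf[symmetric] cong: sum.cong)
  then show ?thesis
    using gately_defined_regular[OF assms] unfolding gately_defined_def by linarith
qed

end

theory Submission
  imports Defs
begin

text \<open>
  Duality exchanges \<open>v {i}\<close> and the marginal contribution of \<open>i\<close>, keeping the worth of \<open>N\<close>. The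
  Gately value is the efficient point on the line through the two vectors, so it is unaffected.
\<close>

lemma dual_game_singleton: "dual_game N v {i} = marginal N v i"
  by (simp add: dual_game_def marginal_def)

lemma dual_game_grand: "coop_game v \<Longrightarrow> dual_game N v N = v N"
  by (simp add: dual_game_def coop_game_def)

lemma marginal_dual_game:
  assumes "coop_game v" "i \<in> N"
  shows "marginal N (dual_game N v) i = v {i}"
proof -
  have "N - (N - {i}) = {i}" using assms(2) by blast
  then show ?thesis
    using assms(1) by (simp add: marginal_def dual_game_def coop_game_def)
qed

text \<open>With \<open>t = (v N - ?m) / (?M - ?m)\<close>, the Gately value is
  \<open>v {i} + t * (marginal N v i - v {i})\<close>. Duality swaps the two endpoints and turns
  \<open>t\<close> into \<open>1 - t\<close>, which gives the same point.\<close>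

lemma dual_gately_eq_gately:
  assumes "coop_game v" "gately_defined N v" "i \<in> N"
  shows "dual_gately N v i = gately N v i"
proof -
  let ?m = "\<Sum>j\<in>N. v {j}" and ?M = "\<Sum>j\<in>N. marginal N v j"
  have "?M - ?m \<noteq> 0"
    using assms(2) by (simp add: gately_defined_def sum_subtractf)
  \<comment> \<open>The left side is the Gately formula of the dual game, written in terms of
    \<open>v\<close>.\<close>
  then have "marginal N v i + (v {i} - marginal N v i) / (?m - ?M) * (v N - ?M)
      = v {i} + (marginal N v i - v {i}) / (?M - ?m) * (v N - ?m)"
    by (simp add: divide_simps) (simp add: algebra_simps)
  then show ?thesis
    using assms
    by (simp add: dual_gately_def gately_def dual_game_singleton dual_game_grand
        marginal_dual_game sum_subtractf)
qed

theorem corollary3p10: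
  fixes n :: nat and v :: "nat set \<Rightarrow> real"
  assumes "regular_game {1..n} v"
  shows "\<forall>i\<in>{1..n}. dual_gately {1..n} v i = gately {1..n} v i"
  \<comment> \<open>The strict inequality in \<open>standard\<close> makes the denominator
    positive.\<close>
  using assms gately_defined_regular[OF _ assms]
  by (auto simp: regular_game_def intro: dual_gately_eq_gately)

end
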